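(* For any $\alpha_0,\alpha_1,\dots,\alpha_n\in\mathbf{C}$, every element of the $(n-1)$-dimensional Abelian Lie algebra $\mathcal{L}'=\mathrm{span}_{\mathbf{C}}\{Y^1_1,\dots,Y^n_n\}$ is a Lie symmetry of the generalized ladder system with parameters $\alpha_0,\dots,\alpha_n$; hence the generalized ladder system is integrable.
   Context: Coordinates $x=(x_1,\dots,x_n)\in\mathbf{C}^n$, $n\ge2$, on $\{u\ne0\}$. Notation: $u=\sum_{j=1}^n x_j$, $D=\sum_{j=1}^n x_j\,\partial/\partial x_j$, $Y^l_l = x_l u^{-1}\big(D-u\,\partial/\partial x_l\big)$. The generalized ladder system with parameters $\alpha_0,\dots,\alpha_n\in\mathbf{C}$ is the homogeneous Lotka–Volterra system $\dot x_i = x_i\sum_{j=1}^n(\alpha_0+\alpha_i-\alpha_j)x_j$, identified with the vector field $X_f=\sum_i x_i\sum_j(\alpha_0+\alpha_i-\alpha_j)x_j\,\partial/\partial x_i$. A vector field $X$ is a Lie symmetry if $[X_f,X]=0$. *)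

theory Defs
  imports "HOL-Analysis.Analysis"
begin

text \<open>Vector fields on (an open subset of) C^n are represented by their coefficient
  maps complex^'n => complex^'n, i.e. X = sum_i (X x)$i d/dx_i.\<close>

type_synonym 'n vfield = "complex ^ 'n \<Rightarrow> complex ^ 'n"

definition lie_bracket :: "'n::finite vfield \<Rightarrow> 'n vfield \<Rightarrow> 'n vfield" where
  "lie_bracket X Y p = frechet_derivative Y (at p) (X p) - frechet_derivative X (at p) (Y p)"

definition usum :: "complex ^ 'n::finite \<Rightarrow> complex" where
  "usum x = (\<Sum>j\<in>UNIV. x $ j)"

definition ladder_field :: "complex \<Rightarrow> ('n::finite \<Rightarrow> complex) \<Rightarrow> 'n vfield" where
  "ladder_field a0 a x = (\<chi> i. x $ i * (\<Sum>j\<in>UNIV. (a0 + a i - a j) * x $ j))"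

text \<open>Y^l_l = x_l u^{-1} (D - u d/dx_l), with D = sum_j x_j d/dx_j (Euler field).\<close>
definition Yfield :: "'n::finite \<Rightarrow> 'n vfield" where
  "Yfield l x = (\<chi> i. x $ l / usum x * (x $ i - (if i = l then usum x else 0)))"

definition lie_symmetry :: "'n::finite vfield \<Rightarrow> 'n vfield \<Rightarrow> bool" where
  "lie_symmetry Xf X \<longleftrightarrow> (\<forall>p. usum p \<noteq> 0 \<longrightarrow> lie_bracket Xf X p = 0)"

end

theory Submission
  imports Defs
begin

text \<open>Both \<open>X\<^sub>f\<close> and \<open>Z = \<Sum>\<^sub>l c\<^sub>l Y\<^sup>l\<^sub>l\<close> are Kolmogorov fields \<open>x\<^sub>i f\<^sub>i(x)\<close> and
  \<open>x\<^sub>i g\<^sub>i(x)\<close>, and the bracket of two such fields is \<open>x\<^sub>i (Dg\<^sub>i(X\<^sub>f) - Df\<^sub>i(Z))\<close>.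
  Here \<open>f\<^sub>i = (\<alpha>\<^sub>0 + \<alpha>\<^sub>i) u - \<langle>\<alpha>,x\<rangle>\<close> is linear and \<open>g\<^sub>i = \<langle>c,x\<rangle>/u - c\<^sub>i\<close>.
  Since \<open>u(X\<^sub>f) = \<alpha>\<^sub>0 u\<^sup>2\<close> and \<open>u(Z) = 0\<close>, both \<open>Dg\<^sub>i(X\<^sub>f)\<close> and \<open>f\<^sub>i(Z)\<close> equal
  \<open>\<langle>\<alpha>c,x\<rangle> - \<langle>\<alpha>,x\<rangle>\<langle>c,x\<rangle>/u\<close>, independently of \<open>i\<close>.\<close>

definition weighted_sum :: "('n::finite \<Rightarrow> complex) \<Rightarrow> complex ^ 'n \<Rightarrow> complex" where
  "weighted_sum w x = (\<Sum>j\<in>UNIV. w j * x $ j)"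

lemma usum_eq_weighted_sum: "usum x = weighted_sum (\<lambda>_. 1) x"
  by (simp add: usum_def weighted_sum_def)

lemma has_derivative_vec_nth [derivative_intros]:
  "((\<lambda>x. x $ i) has_derivative (\<lambda>h. h $ i)) F"
  by (rule bounded_linear.has_derivative [OF bounded_linear_vec_nth has_derivative_ident])

lemma has_derivative_weighted_sum [derivative_intros]:
  "(weighted_sum w has_derivative weighted_sum w) F"
  unfolding weighted_sum_def [abs_def] by (intro derivative_eq_intros) auto

lemma has_derivative_usum [derivative_intros]: "(usum has_derivative usum) F"
  unfolding usum_eq_weighted_sum [abs_def] by (rule has_derivative_weighted_sum)

lemma has_derivative_vec_lambda:
  fixes f :: "'n::finite \<Rightarrow> 'a::real_normed_vector \<Rightarrow> complex"
  assumes "\<And>i. (f i has_derivative f' i) F"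
  shows "((\<lambda>x. \<chi> i. f i x) has_derivative (\<lambda>h. \<chi> i. f' i h)) F"
proof -
  have axis_sum: "(\<chi> i. v i) = (\<Sum>i\<in>UNIV. axis i (v i) :: complex ^ 'n)" for v
    by (simp add: vec_eq_iff axis_def sum_component if_distrib cong: if_cong)
  have "linear (\<lambda>c. axis i c :: complex ^ 'n)" for i
    by (rule linearI) (auto simp: axis_def vec_eq_iff)
  then have axis: "bounded_linear (\<lambda>c. axis i c :: complex ^ 'n)" for i
    by (simp only: linear_conv_bounded_linear)
  have "((\<lambda>x. \<Sum>i\<in>UNIV. axis i (f i x)) has_derivative (\<lambda>h. \<Sum>i\<in>UNIV. axis i (f' i h))) F"
    by (intro has_derivative_sum bounded_linear.has_derivative [OF axis] assms)
  then show ?thesis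
    by (simp only: axis_sum)
qed

lemma has_derivative_kolmogorov_field:
  fixes f :: "'n::finite \<Rightarrow> complex ^ 'n \<Rightarrow> complex"
  assumes "\<And>i. (f i has_derivative f' i) (at p)"
  shows "((\<lambda>x. \<chi> i. x $ i * f i x) has_derivative
          (\<lambda>h. \<chi> i. h $ i * f i p + p $ i * f' i h)) (at p)"
  by (rule has_derivative_vec_lambda) (auto intro!: derivative_eq_intros assms)

lemma lie_bracket_kolmogorov_fields:
  fixes f g :: "'n::finite \<Rightarrow> complex ^ 'n \<Rightarrow> complex"
  assumes "open S" "p \<in> S"
    and X: "\<And>x. x \<in> S \<Longrightarrow> X x = (\<chi> i. x $ i * f i x)"
    and Y: "\<And>x. x \<in> S \<Longrightarrow> Y x = (\<chi> i. x $ i * g i x)"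
    and "\<And>i. (f i has_derivative f' i) (at p)"
    and "\<And>i. (g i has_derivative g' i) (at p)"
  shows "lie_bracket X Y p = (\<chi> i. p $ i * (g' i (X p) - f' i (Y p)))"
proof -
  have DX: "(X has_derivative (\<lambda>h. \<chi> i. h $ i * f i p + p $ i * f' i h)) (at p)"
    by (rule has_derivative_transform_within_open [OF has_derivative_kolmogorov_field])
      (use assms in auto)
  have DY: "(Y has_derivative (\<lambda>h. \<chi> i. h $ i * g i p + p $ i * g' i h)) (at p)"
    by (rule has_derivative_transform_within_open [OF has_derivative_kolmogorov_field])
      (use assms in auto)
  show ?thesis
    unfolding lie_bracket_def frechet_derivative_at [OF DX, symmetric]
      frechet_derivative_at [OF DY, symmetric]
    using X [OF \<open>p \<in> S\<close>] Y [OF \<open>p \<in> S\<close>]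
    by (simp add: vec_eq_iff algebra_simps)
qed

lemma open_usum_neq_zero: "open {x :: complex ^ 'n::finite. usum x \<noteq> 0}"
  unfolding usum_def by (intro open_Collect_neq continuous_intros)

lemma ladder_field_kolmogorov:
  "ladder_field a0 a x = (\<chi> i. x $ i * ((a0 + a i) * usum x - weighted_sum a x))"
  unfolding ladder_field_def usum_def weighted_sum_def
  by (simp add: algebra_simps sum_subtractf sum_distrib_left sum.distrib)

lemma weighted_sum_ladder_field:
  "weighted_sum w (ladder_field a0 a x)
     = (a0 * usum x - weighted_sum a x) * weighted_sum w x
       + usum x * weighted_sum (\<lambda>j. w j * a j) x"
proof -
  have "weighted_sum w (ladder_field a0 a x)
      = (\<Sum>j\<in>UNIV. (a0 * usum x - weighted_sum a x) * (w j * x $ j) + usum x * (w j * a j * x $ j))"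
    unfolding ladder_field_kolmogorov weighted_sum_def by (intro sum.cong) (auto simp: algebra_simps)
  then show ?thesis
    by (simp add: weighted_sum_def sum.distrib sum_distrib_left)
qed

lemma usum_ladder_field: "usum (ladder_field a0 a x) = a0 * (usum x)\<^sup>2"
  using weighted_sum_ladder_field [of "\<lambda>_. 1" a0 a x]
  by (simp add: usum_eq_weighted_sum algebra_simps power2_eq_square)

definition symmetry_field :: "('n::finite \<Rightarrow> complex) \<Rightarrow> 'n vfield" where
  "symmetry_field c x = (\<chi> i. x $ i * (weighted_sum c x / usum x - c i))"

lemma sum_Yfield_eq_symmetry_field:
  assumes "usum x \<noteq> 0"
  shows "(\<Sum>l\<in>UNIV. (\<chi> i. c l * Yfield l x $ i)) = symmetry_field c x"
proof -
  have "(\<Sum>l\<in>UNIV. c l * Yfield l x $ i)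
          = (\<Sum>l\<in>UNIV. c l * x $ l * x $ i / usum x - (if l = i then c i * x $ i else 0))" for i
    using assms by (intro sum.cong) (auto simp: Yfield_def field_simps)
  then show ?thesis
    by (simp add: symmetry_field_def vec_eq_iff sum_component sum_subtractf weighted_sum_def
        sum_divide_distrib sum_distrib_left algebra_simps)
qed

lemma weighted_sum_symmetry_field:
  "weighted_sum w (symmetry_field c x)
     = weighted_sum w x * weighted_sum c x / usum x - weighted_sum (\<lambda>j. w j * c j) x"
  unfolding symmetry_field_def weighted_sum_def
  by (simp add: algebra_simps sum_subtractf sum_distrib_left sum_distrib_right sum_divide_distrib)

lemma usum_symmetry_field:
  assumes "usum x \<noteq> 0"
  shows "usum (symmetry_field c x) = 0"
  using assms weighted_sum_symmetry_field [of "\<lambda>_. 1" c x]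
  by (simp add: usum_eq_weighted_sum)

lemma has_derivative_symmetry_coefficient:
  assumes "usum p \<noteq> 0"
  shows "((\<lambda>x. weighted_sum c x / usum x - c i) has_derivative
          (\<lambda>h. (weighted_sum c h * usum p - weighted_sum c p * usum h) / (usum p)\<^sup>2)) (at p)"
  using assms unfolding usum_eq_weighted_sum
  by (auto intro!: derivative_eq_intros simp: field_simps power2_eq_square)

lemma symmetry_coefficient_derivative_along_ladder_field:
  assumes "usum p \<noteq> 0"
  shows "(weighted_sum c (ladder_field a0 a p) * usum p
            - weighted_sum c p * usum (ladder_field a0 a p)) / (usum p)\<^sup>2
         = weighted_sum (\<lambda>j. c j * a j) p - weighted_sum a p * weighted_sum c p / usum p"
  using assms by (simp add: weighted_sum_ladder_field usum_ladder_field field_simps power2_eq_square)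

lemma ladder_coefficient_at_symmetry_field:
  assumes "usum p \<noteq> 0"
  shows "(a0 + a i) * usum (symmetry_field c p) - weighted_sum a (symmetry_field c p)
         = weighted_sum (\<lambda>j. c j * a j) p - weighted_sum a p * weighted_sum c p / usum p"
  using assms by (simp add: usum_symmetry_field weighted_sum_symmetry_field mult.commute)

theorem theorem3:
  fixes a0 :: complex and a :: "'n::finite \<Rightarrow> complex" and c :: "'n \<Rightarrow> complex"
  assumes "CARD('n) \<ge> 2"
  shows "lie_symmetry (ladder_field a0 a) (\<lambda>x. \<Sum>l\<in>UNIV. (\<chi> i. c l * Yfield l x $ i))"
  unfolding lie_symmetry_def
proof (intro allI impI)
  fix p :: "complex ^ 'n"
  assume u: "usum p \<noteq> 0"
  let ?Z = "\<lambda>x. \<Sum>l\<in>UNIV. (\<chi> i. c l * Yfield l x $ i)"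
  have "lie_bracket (ladder_field a0 a) ?Z p
      = (\<chi> i. p $ i * ((weighted_sum c (ladder_field a0 a p) * usum p
                         - weighted_sum c p * usum (ladder_field a0 a p)) / (usum p)\<^sup>2
                        - ((a0 + a i) * usum (?Z p) - weighted_sum a (?Z p))))"
    by (rule lie_bracket_kolmogorov_fields [OF open_usum_neq_zero,
          where f = "\<lambda>i x. (a0 + a i) * usum x - weighted_sum a x"
            and f' = "\<lambda>i h. (a0 + a i) * usum h - weighted_sum a h"
            and g = "\<lambda>i x. weighted_sum c x / usum x - c i"])
      (use u in \<open>auto simp: ladder_field_kolmogorov sum_Yfield_eq_symmetry_field symmetry_field_def
         has_derivative_symmetry_coefficient intro!: derivative_eq_intros\<close>)
  also have "\<dots> = 0"
    using u by (simp add: vec_eq_iff sum_Yfield_eq_symmetry_field ladder_coefficient_at_symmetry_field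
        symmetry_coefficient_derivative_along_ladder_field)
  finally show "lie_bracket (ladder_field a0 a) ?Z p = 0" .
qed

end
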